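(* For the DSPI (decentralized shortest path interdiction) game with continuous interdiction and $F$ agents on the ladder network described in the context, with cost parameter $\epsilon$, the worst-case price of anarchy is at least $\dfrac{F+1}{2+\epsilon}$.
   Context: Ladder network: the directed graph has $2(F+1)$ vertices $a_1,\dots,a_{F+1},b_1,\dots,b_{F+1}$ and arcs: horizontal arcs $(a_i,a_{i+1})$ and $(b_i,b_{i+1})$ for $i=1,\dots,F$, and vertical arcs $(a_i,b_i)$ for $i=1,\dots,F+1$. All initial arc lengths are $0$. For every agent, the cost of interdiction per unit is $1$ on each vertical arc and the higher value $1+\epsilon$ on each horizontal arc. There are $F$ agents, each with budget $1$; agent $f\in\{1,\dots,F\}$ has source $a_1$ and target $b_{f+1}$. Game: agent $f$ chooses $x^f\in\mathbb R^{A}_{\ge0}$ with $\sum_{(u,v)\in A}c_{uv}x^f_{uv}\le1$ (here $A$ is the arc set and $c_{uv}$ the costs) to maximize $\theta^f(x^f,x^{-f})$, the length of a shortest $a_1$-$b_{f+1}$ path when arc $(u,v)$ has length $\sum_{g=1}^Fx^g_{uv}$. An equilibrium is a pure strategy Nash equilibrium. Worst-case price of anarchy: for an instance $I$ of the game (given by the network, the agents' obstruction functions $\theta^f$, the budgets $b^f$ and the costs $c^f_{uv}$), let $\theta^c(x^1,\dots,x^F)=\sum_{f=1}^F\theta^f(x^f,x^{-f})$ and let $(x^{1*},\dots,x^{F*})$ maximize $\theta^c$ subject to the pooled budget constraint $\sum_{f=1}^F\sum_{(u,v)\in A}c^f_{uv}x^f_{uv}\le\sum_{f=1}^F b^f$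 and $x^f\ge0$ for all $f$. The price of anarchy $p(I)$ of the instance is the maximum, over all equilibria $(x^1_N,\dots,x^F_N)$ of the instance, of $\theta^c(x^{1*},\dots,x^{F*})/\theta^c(x^1_N,\dots,x^F_N)$ (set to $1$ if the worst equilibrium and the optimum both have value $0$, and to $+\infty$ if the worst equilibrium has value $0$ and the optimum does not). The worst-case price of anarchy is $\sup_{I\in\mathcal I}p(I)$, where $\mathcal I$ is the set of all instances of the game, which includes the ladder instance above. *)

theory Defs
  imports Graph_Theory.Shortest_Path Graph_Theory.Pair_Digraph
begin

section \<open>Decentralized shortest path interdiction with continuous interdiction\<close>

text \<open>Agents are numbered \<open>1, \<dots>, num_agents\<close>; arcs are ordered pairs of vertices.\<close>

record 'v dspi =
  network :: "'v pair_pre_digraph"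
  num_agents :: nat
  source :: "nat \<Rightarrow> 'v"
  target :: "nat \<Rightarrow> 'v"
  init_length :: "'v \<times> 'v \<Rightarrow> real"
  cost :: "nat \<Rightarrow> 'v \<times> 'v \<Rightarrow> real"
  budget :: "nat \<Rightarrow> real"

text \<open>A profile \<open>x\<close> gives the amount \<open>x f e\<close> by which agent \<open>f\<close> extends arc \<open>e\<close>; its values
  outside the arcs and the agents of the instance are irrelevant.\<close>

type_synonym 'v profile = "nat \<Rightarrow> 'v \<times> 'v \<Rightarrow> real"

definition agents :: "'v dspi \<Rightarrow> nat set" where
  "agents I = {1..num_agents I}"

definition arc_length :: "'v dspi \<Rightarrow> 'v profile \<Rightarrow> 'v \<times> 'v \<Rightarrow> real" where
  "arc_length I x e = init_length I e + (\<Sum>g\<in>agents I. x g e)"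

text \<open>The library's \<open>wf_digraph.\<mu>\<close> is an infimum over walks; on nonnegative arc lengths this is
  the length of a shortest path.\<close>

definition obstruction :: "'v dspi \<Rightarrow> nat \<Rightarrow> 'v profile \<Rightarrow> ereal" where
  "obstruction I f x =
     wf_digraph.\<mu> (with_proj (network I)) (arc_length I x) (source I f) (target I f)"

definition total_obstruction :: "'v dspi \<Rightarrow> 'v profile \<Rightarrow> ereal" where
  "total_obstruction I x = (\<Sum>f\<in>agents I. obstruction I f x)"

definition spending :: "'v dspi \<Rightarrow> nat \<Rightarrow> ('v \<times> 'v \<Rightarrow> real) \<Rightarrow> real" where
  "spending I f y = (\<Sum>e\<in>parcs (network I). cost I f e * y e)"

definition strategies :: "'v dspi \<Rightarrow> nat \<Rightarrow> ('v \<times> 'v \<Rightarrow> real) set" where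
  "strategies I f = {y. (\<forall>e\<in>parcs (network I). 0 \<le> y e) \<and> spending I f y \<le> budget I f}"

definition equilibrium :: "'v dspi \<Rightarrow> 'v profile \<Rightarrow> bool" where
  "equilibrium I x \<longleftrightarrow>
     (\<forall>f\<in>agents I. x f \<in> strategies I f \<and>
        (\<forall>y\<in>strategies I f. obstruction I f (x(f := y)) \<le> obstruction I f x))"

definition pooled_profiles :: "'v dspi \<Rightarrow> 'v profile set" where
  "pooled_profiles I =
     {x. (\<forall>f\<in>agents I. \<forall>e\<in>parcs (network I). 0 \<le> x f e) \<and>
         (\<Sum>f\<in>agents I. spending I f (x f)) \<le> (\<Sum>f\<in>agents I. budget I f)}"

definition social_optimum :: "'v dspi \<Rightarrow> ereal" where
  "social_optimum I = (SUP x\<in>pooled_profiles I. total_obstruction I x)"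

definition value_ratio :: "ereal \<Rightarrow> ereal \<Rightarrow> ereal" where
  "value_ratio v w = (if w = 0 then (if v = 0 then 1 else \<infinity>) else v / w)"

definition price_of_anarchy :: "'v dspi \<Rightarrow> ereal" where
  "price_of_anarchy I =
     (SUP x\<in>{x. equilibrium I x}. value_ratio (social_optimum I) (total_obstruction I x))"

text \<open>Vertices are natural numbers, so that the instances form a set; every finite digraph has an
  isomorphic copy of this kind.\<close>

definition dspi_instances :: "nat \<Rightarrow> nat dspi set" where
  "dspi_instances F =
     {I. num_agents I = F \<and> pair_fin_digraph (network I) \<and>
         (\<forall>e\<in>parcs (network I). 0 \<le> init_length I e) \<and>
         (\<forall>f\<in>agents I. 0 \<le> budget I f \<and> (\<forall>e\<in>parcs (network I). 0 < cost I f e) \<and>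
            source I f \<noteq> target I f \<and>
            source I f \<rightarrow>\<^sup>*\<^bsub>with_proj (network I)\<^esub> target I f)}"

definition worst_case_price_of_anarchy :: "nat \<Rightarrow> ereal" where
  "worst_case_price_of_anarchy F = (SUP I\<in>dspi_instances F. price_of_anarchy I)"

section \<open>The ladder network\<close>

definition vert_a :: "nat \<Rightarrow> nat" where
  "vert_a i = 2 * i"

definition vert_b :: "nat \<Rightarrow> nat" where
  "vert_b i = 2 * i + 1"

definition horizontal_arcs :: "nat \<Rightarrow> (nat \<times> nat) set" where
  "horizontal_arcs F =
     (\<lambda>i. (vert_a i, vert_a (i + 1))) ` {1..F} \<union> (\<lambda>i. (vert_b i, vert_b (i + 1))) ` {1..F}"

definition vertical_arcs :: "nat \<Rightarrow> (nat \<times> nat) set" where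
  "vertical_arcs F = (\<lambda>i. (vert_a i, vert_b i)) ` {1..F + 1}"

definition ladder :: "nat \<Rightarrow> real \<Rightarrow> nat dspi" where
  "ladder F \<epsilon> =
     \<lparr> network = \<lparr> pverts = vert_a ` {1..F + 1} \<union> vert_b ` {1..F + 1},
                   parcs = horizontal_arcs F \<union> vertical_arcs F \<rparr>,
       num_agents = F,
       source = (\<lambda>f. vert_a 1),
       target = (\<lambda>f. vert_b (f + 1)),
       init_length = (\<lambda>e. 0),
       cost = (\<lambda>f e. if e \<in> vertical_arcs F then 1 else 1 + \<epsilon>),
       budget = (\<lambda>f. 1) \<rparr>"

end

theory Submission
  imports Defs
begin

text \<open>
  In the equilibrium each agent \<open>f\<close> spends \<open>1 / (F + 1)\<close> on the first vertical arc and the rest,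
  \<open>F / (F + 1)\<close>, on the vertical arc into its own target, so that every vertical arc has length
  \<open>F / (F + 1)\<close>. The walk that descends first and the walk that descends last are arc-disjoint,
  and the other agents contribute \<open>(F - 1) / (F + 1)\<close> to their joint length. With a unit budget
  and unit costs at least \<open>1\<close>, agent \<open>f\<close> cannot push the shorter of the two beyond
  \<open>F / (F + 1)\<close>. A central planner instead spends everything on the two arcs
  leaving the common source, which separates it from all targets at a cost of \<open>2 + \<epsilon>\<close> per unit
  of length.
\<close>

section \<open>Potentials as lower bounds on distances\<close>

text \<open>The increments of \<open>d\<close> telescope along the walk, and each is bounded by the
  weight of its arc.\<close>

lemma (in wf_digraph) potential_le_awalk_cost:
  assumes "awalk u p v"
    and "\<And>e. e \<in> arcs G \<Longrightarrow> d (head G e) - d (tail G e) \<le> w e"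
  shows "d v - d u \<le> awalk_cost w p"
  using assms(1)
proof (induction p arbitrary: u)
  case Nil
  then show ?case by (simp add: awalk_Nil_iff)
next
  case (Cons e p)
  then have "e \<in> arcs G" "u = tail G e" "awalk (head G e) p v"
    by (auto simp: awalk_Cons_iff)
  with Cons.IH[of "head G e"] assms(2)[of e] show ?case by simp
qed

text \<open>Weak duality for shortest paths: one feasible potential bounds all walks at once. Both
  lower bounds on obstructions below rest on it.\<close>

lemma (in wf_digraph) potential_le_mu:
  assumes "\<And>e. e \<in> arcs G \<Longrightarrow> d (head G e) - d (tail G e) \<le> w e"
  shows "ereal (d v - d u) \<le> \<mu> w u v"
  unfolding \<mu>_def using potential_le_awalk_cost[where d = d and w = w, OF _ assms]
  by (auto intro!: INF_greatest)

lemma (in pair_wf_digraph) awalk_chain: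
  assumes "m \<le> n" "v m \<in> pverts G" "\<And>i. m \<le> i \<Longrightarrow> i < n \<Longrightarrow> (v i, v (i + 1)) \<in> parcs G"
  shows "awalk (v m) (map (\<lambda>i. (v i, v (i + 1))) [m..<n]) (v n)"
  using assms
proof (induction n rule: dec_induct)
  case base
  then show ?case by (simp add: awalk_Nil_iff)
next
  case (step n)
  then have "awalk (v m) (map (\<lambda>i. (v i, v (i + 1))) [m..<n]) (v n)" by simp
  moreover have "awalk (v n) [(v n, v (n + 1))] (v (n + 1))"
    using step.prems(2)[of n] step.hyps by (auto simp: awalk_simps dest: wellformed')
  ultimately show ?case using step.hyps by (simp del: awalk_Cons_iff)
qed

section \<open>Arcs and spending on the ladder\<close>

text \<open>The three arc families get opaque names, so that sums over arcs become sums over indices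
  and arcs are compared without unfolding pairs.\<close>

definition arc_a :: "nat \<Rightarrow> nat \<times> nat" where
  "arc_a i = (vert_a i, vert_a (i + 1))"

definition arc_b :: "nat \<Rightarrow> nat \<times> nat" where
  "arc_b i = (vert_b i, vert_b (i + 1))"

definition arc_v :: "nat \<Rightarrow> nat \<times> nat" where
  "arc_v i = (vert_a i, vert_b i)"

lemma vert_simps [simp]:
  "vert_a i = vert_a j \<longleftrightarrow> i = j" "vert_b i = vert_b j \<longleftrightarrow> i = j"
  "vert_a i \<noteq> vert_b j" "vert_b j \<noteq> vert_a i"
  unfolding vert_a_def vert_b_def by presburger+

lemma arc_simps [simp]:
  "arc_a i = arc_a j \<longleftrightarrow> i = j" "arc_b i = arc_b j \<longleftrightarrow> i = j" "arc_v i = arc_v j \<longleftrightarrow> i = j"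
  "arc_a i \<noteq> arc_b j" "arc_b j \<noteq> arc_a i" "arc_a i \<noteq> arc_v j"
  "arc_v j \<noteq> arc_a i" "arc_b i \<noteq> arc_v j" "arc_v j \<noteq> arc_b i"
  by (auto simp: arc_a_def arc_b_def arc_v_def)

lemma inj_on_arc [simp]: "inj_on arc_a A" "inj_on arc_b A" "inj_on arc_v A"
  by (auto simp: inj_on_def)

lemma ladder_simps [simp]:
  "parcs (network (ladder F \<epsilon>)) = arc_a ` {1..F} \<union> arc_b ` {1..F} \<union> arc_v ` {1..F + 1}"
  "pverts (network (ladder F \<epsilon>)) = vert_a ` {1..F + 1} \<union> vert_b ` {1..F + 1}"
  "agents (ladder F \<epsilon>) = {1..F}"
  "num_agents (ladder F \<epsilon>) = F"
  "source (ladder F \<epsilon>) f = vert_a 1"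
  "target (ladder F \<epsilon>) f = vert_b (f + 1)"
  "init_length (ladder F \<epsilon>) e = 0"
  "budget (ladder F \<epsilon>) f = 1"
  by (auto simp: ladder_def agents_def horizontal_arcs_def vertical_arcs_def
      arc_a_def arc_b_def arc_v_def)

lemma cost_ladder [simp]:
  "cost (ladder F \<epsilon>) f (arc_a i) = 1 + \<epsilon>"
  "cost (ladder F \<epsilon>) f (arc_b i) = 1 + \<epsilon>"
  "1 \<le> i \<Longrightarrow> i \<le> F + 1 \<Longrightarrow> cost (ladder F \<epsilon>) f (arc_v i) = 1"
  by (auto simp: ladder_def vertical_arcs_def arc_a_def arc_b_def arc_v_def image_iff)

lemma spending_ladder:
  "spending (ladder F \<epsilon>) f y =
     (1 + \<epsilon>) * (\<Sum>i = 1..F. y (arc_a i)) + (1 + \<epsilon>) * (\<Sum>i = 1..F. y (arc_b i))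
       + (\<Sum>i = 1..F + 1. y (arc_v i))"
proof -
  have "spending (ladder F \<epsilon>) f y =
     (\<Sum>e\<in>arc_a ` {1..F}. cost (ladder F \<epsilon>) f e * y e)
     + (\<Sum>e\<in>arc_b ` {1..F}. cost (ladder F \<epsilon>) f e * y e)
     + (\<Sum>e\<in>arc_v ` {1..F + 1}. cost (ladder F \<epsilon>) f e * y e)"
    unfolding spending_def ladder_simps
    by (subst sum.union_disjoint; (subst sum.union_disjoint)?) auto
  then show ?thesis
    by (simp add: sum.reindex sum_distrib_left del: sum.cl_ivl_Suc)
qed

lemma pair_fin_digraph_ladder: "pair_fin_digraph (network (ladder F \<epsilon>))"
  by unfold_locales (auto simp: arc_a_def arc_b_def arc_v_def)

interpretation ladder: pair_fin_digraph "network (ladder F \<epsilon>)" for F \<epsilon>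
  by (rule pair_fin_digraph_ladder)

section \<open>The two extreme walks to a target\<close>

definition first_descent :: "nat \<Rightarrow> (nat \<times> nat) list" where
  "first_descent f = arc_v 1 # map arc_b [1..<f + 1]"

definition last_descent :: "nat \<Rightarrow> (nat \<times> nat) list" where
  "last_descent f = map arc_a [1..<f + 1] @ [arc_v (f + 1)]"

lemma awalk_first_descent:
  assumes "f \<in> {1..F}"
  shows "ladder.awalk F \<epsilon> (vert_a 1) (first_descent f) (vert_b (f + 1))"
proof -
  have "ladder.awalk F \<epsilon> (vert_b 1) (map arc_b [1..<f + 1]) (vert_b (f + 1))"
    using ladder.awalk_chain[of 1 "f + 1" vert_b F \<epsilon>] assms
    by (simp add: arc_b_def[abs_def] image_iff del: upt_Suc)
  then show ?thesis
    unfolding first_descent_def using assms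
    by (subst ladder.awalk_Cons_iff) (auto simp: arc_v_def)
qed

lemma awalk_last_descent:
  assumes "f \<in> {1..F}"
  shows "ladder.awalk F \<epsilon> (vert_a 1) (last_descent f) (vert_b (f + 1))"
proof -
  have "ladder.awalk F \<epsilon> (vert_a 1) (map arc_a [1..<f + 1]) (vert_a (f + 1))"
    using ladder.awalk_chain[of 1 "f + 1" vert_a F \<epsilon>] assms
    by (simp add: arc_a_def[abs_def] image_iff del: upt_Suc)
  moreover have "ladder.awalk F \<epsilon> (vert_a (f + 1)) [arc_v (f + 1)] (vert_b (f + 1))"
    using assms by (auto simp: ladder.awalk_simps arc_v_def)
  ultimately show ?thesis
    unfolding last_descent_def by (rule ladder.awalk_appendI)
qed

lemma awalk_cost_descents:
  "wf_digraph.awalk_cost w (first_descent f) = w (arc_v 1) + (\<Sum>i = 1..f. w (arc_b i))"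
  "wf_digraph.awalk_cost w (last_descent f) = (\<Sum>i = 1..f. w (arc_a i)) + w (arc_v (f + 1))"
  by (simp_all add: first_descent_def last_descent_def ladder.awalk_cost_def
      interv_sum_list_conv_sum_set_nat comp_def atLeastLessThanSuc_atLeastAtMost del: upt_Suc)

lemma ladder_mem_dspi_instances:
  assumes "\<epsilon> > 0"
  shows "ladder F \<epsilon> \<in> dspi_instances F"
proof -
  have "vert_a 1 \<rightarrow>\<^sup>*\<^bsub>with_proj (network (ladder F \<epsilon>))\<^esub> vert_b (f + 1)" if "f \<in> {1..F}" for f
    using awalk_first_descent[OF that] by (rule ladder.reachable_awalkI)
  then show ?thesis
    using assms pair_fin_digraph_ladder[of F \<epsilon>] by (auto simp: dspi_instances_def)
qed

section \<open>The equilibrium\<close>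

definition ladder_equilibrium :: "nat \<Rightarrow> nat profile" where
  "ladder_equilibrium F f e =
     (if e = arc_v 1 then 1 / (real F + 1)
      else if e = arc_v (f + 1) then real F / (real F + 1) else 0)"

lemma arc_length_ladder_equilibrium:
  "arc_length (ladder F \<epsilon>) (ladder_equilibrium F) (arc_a i) = 0"
  "arc_length (ladder F \<epsilon>) (ladder_equilibrium F) (arc_b i) = 0"
  "i \<in> {1..F + 1} \<Longrightarrow>
     arc_length (ladder F \<epsilon>) (ladder_equilibrium F) (arc_v i) = real F / (real F + 1)"
proof -
  show "arc_length (ladder F \<epsilon>) (ladder_equilibrium F) (arc_a i) = 0"
    "arc_length (ladder F \<epsilon>) (ladder_equilibrium F) (arc_b i) = 0"
    by (simp_all add: arc_length_def ladder_equilibrium_def)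
  assume i: "i \<in> {1..F + 1}"
  show "arc_length (ladder F \<epsilon>) (ladder_equilibrium F) (arc_v i) = real F / (real F + 1)"
  proof (cases "i = 1")
    case True
    then show ?thesis by (simp add: arc_length_def ladder_equilibrium_def)
  next
    case False
    \<comment> \<open>Only agent \<open>j = i - 1\<close>, whose target is \<open>vert_b i\<close>,
      extends this arc.\<close>
    with i obtain j where "i = j + 1" "j \<in> {1..F}"
      by (cases i) auto
    then show ?thesis by (simp add: arc_length_def ladder_equilibrium_def sum.delta)
  qed
qed

lemma ladder_equilibrium_mem_strategies:
  assumes "f \<in> {1..F}"
  shows "ladder_equilibrium F f \<in> strategies (ladder F \<epsilon>) f"
proof -
  have "(\<Sum>i = 1..F + 1. ladder_equilibrium F f (arc_v i))
      = (\<Sum>i = 1..F + 1. (if i = 1 then 1 / (real F + 1) else 0)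
          + (if i = f + 1 then real F / (real F + 1) else 0))"
    \<comment> \<open>As \<open>f \<ge> 1\<close>, the indices \<open>1\<close> and
      \<open>f + 1\<close> differ, so at most one of the two summands is nonzero.\<close>
    using assms by (intro sum.cong) (auto simp: ladder_equilibrium_def)
  also have "\<dots> = 1"
    using assms by (simp add: sum.distrib field_simps del: sum.cl_ivl_Suc)
  finally have "spending (ladder F \<epsilon>) f (ladder_equilibrium F f) = 1"
    unfolding spending_ladder by (simp add: ladder_equilibrium_def)
  then show ?thesis
    by (simp add: strategies_def) (simp add: ladder_equilibrium_def)
qed

text \<open>The shorter of the two descents is at most their average, and disjointness lets every
  unit of budget lengthen only one of them.\<close>

lemma obstruction_deviation_le:
  assumes "\<epsilon> > 0" and f: "f \<in> {1..F}" and y: "y \<in> strategies (ladder F \<epsilon>) f"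
  shows "obstruction (ladder F \<epsilon>) f ((ladder_equilibrium F)(f := y)) \<le> real F / (real F + 1)"
proof -
  define w where "w = arc_length (ladder F \<epsilon>) ((ladder_equilibrium F)(f := y))"
  have w: "w e = y e + (\<Sum>g\<in>{1..F} - {f}. ladder_equilibrium F g e)" for e
    using f by (simp add: w_def arc_length_def sum.remove[of _ f])
  have wa: "w (arc_a i) = y (arc_a i)" and wb: "w (arc_b i) = y (arc_b i)" for i
    by (simp_all add: w ladder_equilibrium_def)
  \<comment> \<open>Each of the other \<open>F - 1\<close> agents leaves a share
    \<open>1 / (F + 1)\<close> on the first vertical arc.\<close>
  have wv1: "w (arc_v 1) = y (arc_v 1) + (real F - 1) / (real F + 1)"
    using f by (simp add: w ladder_equilibrium_def of_nat_diff)
  have wvf: "w (arc_v (f + 1)) = y (arc_v (f + 1))"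
    using f by (auto simp: w ladder_equilibrium_def)
  have y0: "0 \<le> y (arc_a i)" "0 \<le> y (arc_b i)" if "i \<in> {1..F}" for i
    using y that by (auto simp: strategies_def)
  have yv0: "0 \<le> y (arc_v i)" if "i \<in> {1..F + 1}" for i
    using y that by (auto simp: strategies_def)
  \<comment> \<open>The walks stop at column \<open>f + 1\<close>, whereas spending is charged on
    the whole ladder; nonnegativity of \<open>y\<close> bridges the gap.\<close>
  have "(\<Sum>i = 1..f. y (arc_a i)) \<le> (\<Sum>i = 1..F. y (arc_a i))"
    "(\<Sum>i = 1..f. y (arc_b i)) \<le> (\<Sum>i = 1..F. y (arc_b i))"
    using f y0 by (auto intro!: sum_mono2)
  moreover have "0 \<le> (\<Sum>i = 1..F. y (arc_a i))" "0 \<le> (\<Sum>i = 1..F. y (arc_b i))"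
    using y0 by (auto intro!: sum_nonneg)
  then have "(\<Sum>i = 1..F. y (arc_a i)) \<le> (1 + \<epsilon>) * (\<Sum>i = 1..F. y (arc_a i))"
    "(\<Sum>i = 1..F. y (arc_b i)) \<le> (1 + \<epsilon>) * (\<Sum>i = 1..F. y (arc_b i))"
    using \<open>\<epsilon> > 0\<close> by (simp_all add: distrib_right)
  moreover have "(\<Sum>i\<in>{1, f + 1}. y (arc_v i)) \<le> (\<Sum>i = 1..F + 1. y (arc_v i))"
    using f yv0 by (intro sum_mono2) auto
  then have "y (arc_v 1) + y (arc_v (f + 1)) \<le> (\<Sum>i = 1..F + 1. y (arc_v i))"
    using f by simp
  moreover have "spending (ladder F \<epsilon>) f y \<le> 1"
    using y by (simp add: strategies_def)
  ultimately have "wf_digraph.awalk_cost w (first_descent f) + wf_digraph.awalk_cost w (last_descent f)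
      \<le> 1 + (real F - 1) / (real F + 1)"
    unfolding spending_ladder awalk_cost_descents wa wb wv1 wvf by linarith
  \<comment> \<open>The joint length is at most twice the claimed bound, so one of the walks meets
    it.\<close>
  also have "\<dots> = 2 * (real F / (real F + 1))"
    by (simp add: field_simps)
  finally have "wf_digraph.awalk_cost w (first_descent f) \<le> real F / (real F + 1)
      \<or> wf_digraph.awalk_cost w (last_descent f) \<le> real F / (real F + 1)"
    by linarith
  moreover have "obstruction (ladder F \<epsilon>) f ((ladder_equilibrium F)(f := y))
      \<le> wf_digraph.awalk_cost w (first_descent f)"
    "obstruction (ladder F \<epsilon>) f ((ladder_equilibrium F)(f := y))
      \<le> wf_digraph.awalk_cost w (last_descent f)"
    unfolding obstruction_def ladder_simps w_def
    by (rule ladder.min_cost_le_walk_cost; rule awalk_first_descent[OF f] awalk_last_descent[OF f])+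
  ultimately show ?thesis
    by (auto intro: order_trans)
qed

lemma obstruction_ladder_equilibrium:
  assumes "\<epsilon> > 0" and f: "f \<in> {1..F}"
  shows "obstruction (ladder F \<epsilon>) f (ladder_equilibrium F) = real F / (real F + 1)"
proof (rule antisym)
  show "obstruction (ladder F \<epsilon>) f (ladder_equilibrium F) \<le> real F / (real F + 1)"
    \<comment> \<open>The agent's own equilibrium strategy is taken as the deviation, which leaves
      the profile unchanged.\<close>
    using obstruction_deviation_le[OF assms ladder_equilibrium_mem_strategies[OF f]] by simp
next
  \<comment> \<open>The potential rises exactly on the vertical arcs, by their common
    length.\<close>
  define d where "d v = (if v \<in> range vert_b then real F / (real F + 1) else 0)" for v
  have "ereal (d (vert_b (f + 1)) - d (vert_a 1))
      \<le> obstruction (ladder F \<epsilon>) f (ladder_equilibrium F)"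
    unfolding obstruction_def ladder_simps
  proof (rule ladder.potential_le_mu)
    fix e assume "e \<in> parcs (network (ladder F \<epsilon>))"
    then consider i where "e = arc_a i" | i where "e = arc_b i"
      | i where "i \<in> {1..F + 1}" "e = arc_v i"
      by auto
    then show "d (snd e) - d (fst e)
        \<le> arc_length (ladder F \<epsilon>) (ladder_equilibrium F) e"
      \<comment> \<open>Lengths are rewritten first, while the arcs are still folded; only then are
        they opened as pairs to evaluate \<open>d\<close>.\<close>
      by cases (auto simp: arc_length_ladder_equilibrium simp del: atLeastAtMost_iff,
          auto simp: d_def arc_a_def arc_b_def arc_v_def)
  qed
  moreover have "d (vert_b (f + 1)) - d (vert_a 1) = real F / (real F + 1)"
    by (auto simp: d_def)
  ultimately show "real F / (real F + 1) \<le> obstruction (ladder F \<epsilon>) f (ladder_equilibrium F)"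
    by simp
qed

lemma equilibrium_ladder_equilibrium:
  assumes "\<epsilon> > 0"
  shows "equilibrium (ladder F \<epsilon>) (ladder_equilibrium F)"
  unfolding equilibrium_def ladder_simps
  using assms ladder_equilibrium_mem_strategies obstruction_deviation_le
    obstruction_ladder_equilibrium by metis

lemma total_obstruction_ladder_equilibrium:
  assumes "\<epsilon> > 0"
  shows "total_obstruction (ladder F \<epsilon>) (ladder_equilibrium F)
    = real F * (real F / (real F + 1))"
proof -
  have "total_obstruction (ladder F \<epsilon>) (ladder_equilibrium F)
      = (\<Sum>f = 1..F. ereal (real F / (real F + 1)))"
    unfolding total_obstruction_def ladder_simps
    by (intro sum.cong refl obstruction_ladder_equilibrium assms)
  then show ?thesis by simp
qed

section \<open>The pooled optimum\<close>

text \<open>All agents act alike: one unit of length on both arcs costs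
  \<open>(1 + \<epsilon>) + 1\<close>, so each agent spends exactly its own budget.\<close>

definition source_cut :: "real \<Rightarrow> nat profile" where
  "source_cut \<epsilon> f e = (if e = arc_a 1 \<or> e = arc_v 1 then 1 / (2 + \<epsilon>) else 0)"

lemma source_cut_mem_pooled_profiles:
  assumes "F \<ge> 1" "\<epsilon> > 0"
  shows "source_cut \<epsilon> \<in> pooled_profiles (ladder F \<epsilon>)"
proof -
  have "(\<Sum>i = 1..F. source_cut \<epsilon> f (arc_a i)) = 1 / (2 + \<epsilon>)" for f
    using assms by (simp add: source_cut_def)
  moreover have "(\<Sum>i = 1..F + 1. source_cut \<epsilon> f (arc_v i)) = 1 / (2 + \<epsilon>)" for f
    using assms by (simp add: source_cut_def del: sum.cl_ivl_Suc)
  moreover have "(\<Sum>i = 1..F. source_cut \<epsilon> f (arc_b i)) = 0" for f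
    by (simp add: source_cut_def)
  ultimately have "spending (ladder F \<epsilon>) f (source_cut \<epsilon> f)
      = (1 + \<epsilon>) * (1 / (2 + \<epsilon>)) + (1 + \<epsilon>) * 0 + 1 / (2 + \<epsilon>)" for f
    unfolding spending_ladder by (simp only:)
  then have "spending (ladder F \<epsilon>) f (source_cut \<epsilon> f) = 1" for f
    using assms by (simp add: field_simps)
  moreover have "0 \<le> source_cut \<epsilon> f e" for f e
    using assms by (simp add: source_cut_def)
  ultimately show ?thesis
    by (simp add: pooled_profiles_def)
qed

lemma obstruction_source_cut_ge:
  assumes "\<epsilon> > 0"
  shows "real F / (2 + \<epsilon>) \<le> obstruction (ladder F \<epsilon>) f (source_cut \<epsilon>)"
proof -
  \<comment> \<open>The potential rises only on arcs leaving the source, where the \<open>F\<close>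
    equal shares add up to \<open>F / (2 + \<epsilon>)\<close>.\<close>
  define d where "d v = (if v = vert_a 1 then 0 else real F / (2 + \<epsilon>))" for v
  have "ereal (d (vert_b (f + 1)) - d (vert_a 1)) \<le> obstruction (ladder F \<epsilon>) f (source_cut \<epsilon>)"
    unfolding obstruction_def ladder_simps
  proof (rule ladder.potential_le_mu)
    fix e assume "e \<in> parcs (network (ladder F \<epsilon>))"
    then show "d (snd e) - d (fst e) \<le> arc_length (ladder F \<epsilon>) (source_cut \<epsilon>) e"
      using assms
      by (auto simp: arc_length_def source_cut_def)
        (auto simp: d_def arc_a_def arc_b_def arc_v_def)
  qed
  then show ?thesis by (simp add: d_def)
qed

lemma social_optimum_ladder_ge:
  assumes "F \<ge> 1" "\<epsilon> > 0"
  shows "real F * (real F / (2 + \<epsilon>)) \<le> social_optimum (ladder F \<epsilon>)"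
proof -
  have "(\<Sum>f = 1..F. ereal (real F / (2 + \<epsilon>))) \<le> total_obstruction (ladder F \<epsilon>) (source_cut \<epsilon>)"
    unfolding total_obstruction_def ladder_simps
    by (intro sum_mono obstruction_source_cut_ge assms)
  also have "\<dots> \<le> social_optimum (ladder F \<epsilon>)"
    unfolding social_optimum_def by (intro SUP_upper source_cut_mem_pooled_profiles assms)
  finally show ?thesis by simp
qed

section \<open>Comparison of the two values\<close>

lemma price_of_anarchy_ladder_ge:
  assumes "F \<ge> 1" "\<epsilon> > 0"
  shows "ereal ((real F + 1) / (2 + \<epsilon>)) \<le> price_of_anarchy (ladder F \<epsilon>)"
proof -
  define w where "w = real F * (real F / (real F + 1))"
  \<comment> \<open>Here \<open>F \<ge> 1\<close> enters: a positive equilibrium value puts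
    \<open>value_ratio\<close> in its quotient branch.\<close>
  have "w > 0" using assms by (simp add: w_def)
  have "ereal ((real F + 1) / (2 + \<epsilon>)) = ereal (real F * (real F / (2 + \<epsilon>))) / ereal w"
    using assms by (simp add: w_def divide_simps)
  also have "\<dots> \<le> social_optimum (ladder F \<epsilon>) / ereal w"
    using \<open>w > 0\<close> social_optimum_ladder_ge[OF assms] by (intro ereal_divide_right_mono) auto
  also have "\<dots> = value_ratio (social_optimum (ladder F \<epsilon>))
      (total_obstruction (ladder F \<epsilon>) (ladder_equilibrium F))"
    unfolding total_obstruction_ladder_equilibrium[OF \<open>\<epsilon> > 0\<close>] w_def[symmetric]
    using \<open>w > 0\<close> by (simp add: value_ratio_def)
  also have "\<dots> \<le> price_of_anarchy (ladder F \<epsilon>)"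
    unfolding price_of_anarchy_def
    by (intro SUP_upper) (simp add: equilibrium_ladder_equilibrium \<open>\<epsilon> > 0\<close>)
  finally show ?thesis .
qed

theorem mainTheorem12:
  fixes F :: nat and \<epsilon> :: real
  assumes "F \<ge> 1" and "\<epsilon> > 0"
  shows "ladder F \<epsilon> \<in> dspi_instances F
    \<and> ereal ((real F + 1) / (2 + \<epsilon>)) \<le> price_of_anarchy (ladder F \<epsilon>)
    \<and> ereal ((real F + 1) / (2 + \<epsilon>)) \<le> worst_case_price_of_anarchy F"
proof -
  have "price_of_anarchy (ladder F \<epsilon>) \<le> worst_case_price_of_anarchy F"
    unfolding worst_case_price_of_anarchy_def
    by (intro SUP_upper ladder_mem_dspi_instances assms)
  with price_of_anarchy_ladder_ge[OF assms] ladder_mem_dspi_instances[OF assms(2)]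
  show ?thesis by (auto intro: order_trans)
qed

end
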